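(* Let $n,d\in\mathbb{N}^*$. Then the SONC cone $C_{n,2d}$ is full-dimensional in the cone $P_{n,2d}$ of nonnegative polynomials; that is, the convex cones $C_{n,2d}\subseteq P_{n,2d}$ have the same dimension.
   Context: Notation: $\mathbb{N}^*=\mathbb{N}\setminus\{0\}$. $\Delta_{n,2d}$ is the simplex with vertices $\mathbf{0},2d\,\mathbf{e}_1,\ldots,2d\,\mathbf{e}_n$ and $\mathcal{L}_{n,2d}=\Delta_{n,2d}\cap\mathbb{Z}^n$. $V(A)$ denotes the set of vertices of $\operatorname{conv}(A)$. A lattice point is even if it lies in $(2\mathbb{N})^n$. The dimension of a convex cone is the dimension of its linear span. Circuit polynomials: Let $A\subset\mathbb{N}^n$ be finite with all elements of $V(A)$ even. A polynomial $f\in\mathbb{R}[x_1,\ldots,x_n]$ supported on $A$ is a circuit polynomial if $f(\mathbf{x})=\sum_{j=0}^r f_{\boldsymbol{\alpha}(j)}\mathbf{x}^{\boldsymbol{\alpha}(j)}+f_{\boldsymbol{\beta}}\mathbf{x}^{\boldsymbol{\beta}}$ with $r\le n$, $\boldsymbol{\alpha}(j),\boldsymbol{\beta}\in A$, $f_{\boldsymbol{\alpha}(j)}>0$, $f_{\boldsymbol{\beta}}\in\mathbb{R}$, such that (C1) $\boldsymbol{\alpha}(0),\ldots,\boldsymbol{\alpha}(r)$ are affinely independent and form $V(A)$; (C2) $\boldsymbol{\beta}=\sum_{j=0}^r\lambda_j\boldsymbol{\alpha}(j)$ with (unique) $\lambda_j>0$, $\sum_j\lambda_j=1$. $\operatorname{Circ}_A$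 is the set of circuit polynomials with support $A$. Cones: $P_{n,2d}$ is the cone of polynomials in $\mathbb{R}[x_1,\ldots,x_n]$ of degree at most $2d$ that are nonnegative on $\mathbb{R}^n$, and $C_{n,2d}=\{\sum_{i=1}^k\mu_ip_i : k\in\mathbb{N}^*,\ \mu_i\ge0,\ p_i\in\operatorname{Circ}_{A}\cap P_{n,2d} \text{ for some } A\subseteq\mathcal{L}_{n,2d}\text{ (depending on } i)\}$ is the cone of SONC polynomials (sums of nonnegative circuit polynomials). *)

theory Defs
  imports "HOL-Analysis.Analysis" "HOL-Library.Poly_Mapping"
begin

text \<open>
  A real polynomial in the variables indexed by the finite type \<open>'n\<close> is a finitely supported map
  from exponent vectors in \<open>nat ^ 'n\<close> to coefficients; \<open>Poly_Mapping.keys f\<close> is its support, and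
  the addition (and multiplication) of \<open>poly_mapping\<close> is that of the polynomial ring.  The number of
  variables is \<open>CARD('n)\<close>.
\<close>

type_synonym 'n mpoly_real = "(nat ^ 'n) \<Rightarrow>\<^sub>0 real"

instantiation poly_mapping :: (type, real_vector) real_vector
begin

lift_definition scaleR_poly_mapping :: "real \<Rightarrow> ('a \<Rightarrow>\<^sub>0 'b) \<Rightarrow> ('a \<Rightarrow>\<^sub>0 'b)"
  is "\<lambda>r f a. r *\<^sub>R f a"
proof -
  fix r :: real and f :: "'a \<Rightarrow> 'b"
  assume "finite {a. f a \<noteq> 0}"
  then show "finite {a. r *\<^sub>R f a \<noteq> 0}"
    by (rule rev_finite_subset) auto
qed

instance
  by standard (transfer; simp add: fun_eq_iff scaleR_add_right scaleR_add_left)+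

end

definition mpoly_eval :: "'n::finite mpoly_real \<Rightarrow> real ^ 'n \<Rightarrow> real" where
  "mpoly_eval f x =
     (\<Sum>a\<in>Poly_Mapping.keys f. Poly_Mapping.lookup f a * (\<Prod>i\<in>UNIV. (x $ i) ^ (a $ i)))"

text \<open>The zero polynomial gets degree \<open>0\<close>, so it has degree at most \<open>2 * d\<close> for every \<open>d\<close>.\<close>

definition mpoly_degree :: "'n::finite mpoly_real \<Rightarrow> nat" where
  "mpoly_degree f = Max (insert 0 ((\<lambda>a. \<Sum>i\<in>UNIV. a $ i) ` Poly_Mapping.keys f))"

definition real_point :: "nat ^ 'n \<Rightarrow> real ^ 'n" where
  "real_point a = (\<chi> i. real (a $ i))"

definition even_point :: "nat ^ 'n \<Rightarrow> bool" where
  "even_point a \<longleftrightarrow> (\<forall>i. even (a $ i))"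

text \<open>
  The vertices of \<open>conv(A)\<close>.  For finite \<open>A\<close> they belong to \<open>A\<close>, so nothing is lost by taking them
  among the elements of \<open>A\<close> and keeping them as integer points.
\<close>

definition vertices :: "(nat ^ 'n::finite) set \<Rightarrow> (nat ^ 'n) set" where
  "vertices A = {a \<in> A. real_point a extreme_point_of (convex hull (real_point ` A))}"

definition scaled_simplex :: "nat \<Rightarrow> (real ^ 'n::finite) set" where
  "scaled_simplex m = convex hull (insert 0 (range (\<lambda>i. real m *\<^sub>R axis i 1)))"

text \<open>The simplex lies in the nonnegative orthant, hence all its integer points have type \<open>nat ^ 'n\<close>.\<close>

definition simplex_lattice_points :: "nat \<Rightarrow> (nat ^ 'n::finite) set" where
  "simplex_lattice_points m = {a. real_point a \<in> scaled_simplex m}"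

text \<open>
  In \<open>circuit_polys\<close>, injectivity of \<open>\<alpha>\<close> on \<open>{..r}\<close> is needed for affine independence of the family
  \<open>\<alpha>(0), \<dots>, \<alpha>(r)\<close>, since \<open>affine_dependent\<close> only speaks about the set of its members.  The
  coefficient \<open>b\<close> of the inner term may be zero or negative, and \<open>\<beta> = \<alpha>(0)\<close> is possible if \<open>r = 0\<close>.
\<close>

definition circuit_polys :: "(nat ^ 'n::finite) set \<Rightarrow> 'n mpoly_real set" where
  "circuit_polys A = {f.
     finite A \<and> (\<forall>a \<in> vertices A. even_point a) \<and> Poly_Mapping.keys f \<subseteq> A \<and>
     (\<exists>(r::nat) (\<alpha>::nat \<Rightarrow> nat ^ 'n) (\<beta>::nat ^ 'n) (c::nat \<Rightarrow> real) (b::real) (l::nat \<Rightarrow> real).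
        r \<le> CARD('n) \<and> (\<forall>j\<le>r. \<alpha> j \<in> A) \<and> \<beta> \<in> A \<and> (\<forall>j\<le>r. c j > 0) \<and>
        f = (\<Sum>j\<le>r. Poly_Mapping.single (\<alpha> j) (c j)) + Poly_Mapping.single \<beta> b \<and>
        inj_on \<alpha> {..r} \<and> \<not> affine_dependent (real_point ` \<alpha> ` {..r}) \<and>
        \<alpha> ` {..r} = vertices A \<and>
        (\<forall>j\<le>r. l j > 0) \<and> (\<Sum>j\<le>r. l j) = 1 \<and>
        real_point \<beta> = (\<Sum>j\<le>r. l j *\<^sub>R real_point (\<alpha> j)))}"

definition nonneg_cone :: "nat \<Rightarrow> 'n::finite mpoly_real set" where
  "nonneg_cone m = {f. mpoly_degree f \<le> m \<and> (\<forall>x. mpoly_eval f x \<ge> 0)}"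

definition sonc_cone :: "nat \<Rightarrow> 'n::finite mpoly_real set" where
  "sonc_cone m = {f. \<exists>(k::nat) (\<mu>::nat \<Rightarrow> real) (p::nat \<Rightarrow> 'n mpoly_real).
     k \<ge> 1 \<and>
     (\<forall>i\<in>{1..k}. \<mu> i \<ge> 0 \<and>
        (\<exists>A \<subseteq> simplex_lattice_points m. p i \<in> circuit_polys A \<inter> nonneg_cone m)) \<and>
     f = (\<Sum>i=1..k. \<mu> i *\<^sub>R p i)}"

end

theory Submission
  imports Defs
begin

text \<open>
  Both cones span the space of all polynomials of degree at most \<open>2 * d\<close>, since every monomial of
  such a degree lies in the span of \<open>sonc_cone (2 * d)\<close>.  An even monomial is itself a circuit
  polynomial.  Otherwise split the exponent as \<open>\<beta> = \<gamma> + \<delta>\<close> with \<open>\<bar>\<gamma>\<bar>, \<bar>\<delta>\<bar> \<le> d\<close>; here \<open>\<gamma> \<noteq> \<delta>\<close>, so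
  \<open>(x\<^sup>\<gamma> + x\<^sup>\<delta>)\<^sup>2\<close> is a nonnegative circuit polynomial with vertices \<open>2\<gamma>\<close>, \<open>2\<delta>\<close> and inner
  exponent \<open>\<beta>\<close>, and subtracting the two even monomials leaves \<open>2x\<^sup>\<beta>\<close>.
\<close>

lemma lookup_scaleR [simp]: "Poly_Mapping.lookup (r *\<^sub>R f) a = r *\<^sub>R Poly_Mapping.lookup f a"
  by transfer simp

lemma poly_mapping_eq_sum_scaleR_single:
  fixes f :: "'a \<Rightarrow>\<^sub>0 real"
  shows "f = (\<Sum>a\<in>Poly_Mapping.keys f. Poly_Mapping.lookup f a *\<^sub>R Poly_Mapping.single a 1)"
proof (rule poly_mapping_eqI)
  fix k
  show "Poly_Mapping.lookup f k = Poly_Mapping.lookup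
    (\<Sum>a\<in>Poly_Mapping.keys f. Poly_Mapping.lookup f a *\<^sub>R Poly_Mapping.single a 1) k"
    by (cases "k \<in> Poly_Mapping.keys f")
       (auto simp: lookup_sum lookup_single when_def in_keys_iff if_distrib cong: if_cong)
qed

lemma keys_scaleR: "Poly_Mapping.keys (r *\<^sub>R f) \<subseteq> Poly_Mapping.keys f"
  by (auto simp: in_keys_iff)

text \<open>Cancellation can shrink the support of a sum or a multiple, so evaluations are compared
  over a common finite index set; the added terms have coefficient zero.\<close>

lemma mpoly_eval_superset:
  assumes "finite S" "Poly_Mapping.keys f \<subseteq> S"
  shows "mpoly_eval f x = (\<Sum>a\<in>S. Poly_Mapping.lookup f a * (\<Prod>i\<in>UNIV. (x $ i) ^ (a $ i)))"
  unfolding mpoly_eval_def using assms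
  by (intro sum.mono_neutral_left) (auto simp: in_keys_iff)

lemma mpoly_eval_add: "mpoly_eval (f + g) x = mpoly_eval f x + mpoly_eval g x"
proof -
  let ?S = "Poly_Mapping.keys f \<union> Poly_Mapping.keys g"
  show ?thesis
    using keys_add[of f g]
    by (simp add: mpoly_eval_superset[of ?S] lookup_add distrib_right sum.distrib)
qed

lemma mpoly_eval_scaleR: "mpoly_eval (r *\<^sub>R f) x = r * mpoly_eval f x"
  using keys_scaleR[of r f]
  by (simp add: mpoly_eval_superset[of "Poly_Mapping.keys f"] sum_distrib_left mult.assoc)

lemma mpoly_eval_zero: "mpoly_eval 0 x = 0"
  by (simp add: mpoly_eval_def)

lemma mpoly_eval_single:
  "mpoly_eval (Poly_Mapping.single a c) x = c * (\<Prod>i\<in>UNIV. (x $ i) ^ (a $ i))"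
  by (simp add: mpoly_eval_superset[of "{a}"])

text \<open>The \<open>0\<close> inserted into the degree set keeps \<open>Max\<close> meaningful
  for the zero polynomial and adds no condition, as \<open>0 \<le> m\<close>.\<close>

lemma mpoly_degree_le_iff:
  "mpoly_degree f \<le> m \<longleftrightarrow> (\<forall>a\<in>Poly_Mapping.keys f. (\<Sum>i\<in>UNIV. a $ i) \<le> m)"
  by (simp add: mpoly_degree_def)

lemma nonneg_cone_zero: "0 \<in> nonneg_cone m"
  by (simp add: nonneg_cone_def mpoly_degree_le_iff mpoly_eval_zero)

lemma nonneg_cone_add: "f \<in> nonneg_cone m \<Longrightarrow> g \<in> nonneg_cone m \<Longrightarrow> f + g \<in> nonneg_cone m"
  using keys_add[of f g] by (auto simp: nonneg_cone_def mpoly_degree_le_iff mpoly_eval_add)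

lemma nonneg_cone_scaleR: "f \<in> nonneg_cone m \<Longrightarrow> r \<ge> 0 \<Longrightarrow> r *\<^sub>R f \<in> nonneg_cone m"
  using keys_scaleR[of r f] by (auto simp: nonneg_cone_def mpoly_degree_le_iff mpoly_eval_scaleR)

lemma nonneg_cone_sum: "(\<And>i. i \<in> S \<Longrightarrow> f i \<in> nonneg_cone m) \<Longrightarrow> sum f S \<in> nonneg_cone m"
  by (induction S rule: infinite_finite_induct) (auto simp: nonneg_cone_zero nonneg_cone_add)

lemma sonc_cone_subset_nonneg_cone: "sonc_cone m \<subseteq> nonneg_cone m"
  unfolding sonc_cone_def by (auto intro!: nonneg_cone_sum nonneg_cone_scaleR)

lemma circuit_in_sonc_cone:
  assumes "f \<in> circuit_polys A" "A \<subseteq> simplex_lattice_points m" "f \<in> nonneg_cone m"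
  shows "f \<in> sonc_cone m"
  unfolding sonc_cone_def using assms
  by (intro CollectI exI[of _ 1] exI[of _ "\<lambda>_. 1"] exI[of _ "\<lambda>_. f"]) auto

lemma simplex_lattice_pointsI:
  fixes a :: "nat ^ 'n::finite"
  assumes "(\<Sum>i\<in>UNIV. a $ i) \<le> m" "m > 0"
  shows "a \<in> simplex_lattice_points m"
proof -
  let ?H = "scaled_simplex m :: (real ^ 'n) set"
  \<comment> \<open>Barycentric coordinates: \<open>Some i\<close> stands for the vertex
    \<open>m e_i\<close> with weight \<open>a_i / m\<close>, and \<open>None\<close> for the origin,
    which absorbs the remaining weight.\<close>
  define w where "w = (\<lambda>j. case j of None \<Rightarrow> 1 - (\<Sum>i\<in>UNIV. real (a $ i) / m)
    | Some i \<Rightarrow> real (a $ i) / m)"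
  define y :: "'n option \<Rightarrow> real ^ 'n" where
    "y = (\<lambda>j. case j of None \<Rightarrow> 0 | Some i \<Rightarrow> real m *\<^sub>R axis i 1)"
  have le: "(\<Sum>i\<in>UNIV. real (a $ i) / m) \<le> 1"
    using assms by (simp flip: sum_divide_distrib of_nat_sum)
  have "(\<Sum>j\<in>UNIV. w j *\<^sub>R y j) \<in> ?H"
  proof (rule convex_sum)
    show "convex ?H" by (simp add: scaled_simplex_def)
    show "sum w UNIV = 1" by (simp add: UNIV_option_conv sum.reindex w_def)
    show "w j \<ge> 0" for j using le by (auto simp: w_def split: option.split)
    show "y j \<in> ?H" for j
      by (auto simp: y_def scaled_simplex_def intro: hull_inc split: option.split)
  qed simp
  also have "(\<Sum>j\<in>UNIV. w j *\<^sub>R y j) = (\<Sum>i\<in>UNIV. real (a $ i) *\<^sub>R axis i 1)"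
    using assms by (simp add: UNIV_option_conv sum.reindex w_def y_def)
  also have "\<dots> = real_point a"
    by (simp add: vec_eq_iff real_point_def axis_def if_distrib cong: if_cong)
  finally show ?thesis by (simp add: simplex_lattice_points_def)
qed

lemma single_in_sonc_cone:
  fixes a :: "nat ^ 'n::finite"
  assumes "even_point a" "(\<Sum>i\<in>UNIV. a $ i) \<le> m" "m > 0"
  shows "Poly_Mapping.single a 1 \<in> sonc_cone m"
proof (rule circuit_in_sonc_cone)
  have v: "vertices {a} = {a}"
    by (auto simp: vertices_def)
  \<comment> \<open>The degenerate circuit with \<open>r = 0\<close>: the inner exponent coincides
    with the only vertex \<open>a\<close> and gets coefficient \<open>0\<close>.\<close>
  show "Poly_Mapping.single a 1 \<in> circuit_polys {a}"
    unfolding circuit_polys_def mem_Collect_eq v using assms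
    by (intro conjI exI[of _ 0] exI[of _ "\<lambda>_. a"] exI[of _ a] exI[of _ "\<lambda>_. 1"]) auto
  show "{a} \<subseteq> simplex_lattice_points m"
    using assms by (simp add: simplex_lattice_pointsI)
  show "Poly_Mapping.single a 1 \<in> nonneg_cone m"
    using assms
    by (auto simp: nonneg_cone_def mpoly_degree_le_iff mpoly_eval_single even_point_def
        intro!: prod_nonneg zero_le_even_power)
qed

text \<open>Units are moved one at a time from \<open>h\<close> to \<open>g\<close>; while the
  entries of \<open>g\<close> sum to less than those of \<open>b\<close>, some entry of
  \<open>h\<close> is still positive.\<close>

lemma split_exponent:
  fixes b :: "nat ^ 'n::finite"
  assumes "k \<le> (\<Sum>i\<in>UNIV. b $ i)"
  shows "\<exists>g h. b = g + h \<and> (\<Sum>i\<in>UNIV. g $ i) = k"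
  using assms
proof (induction k)
  case 0
  show ?case by (intro exI[of _ 0] exI[of _ b]) simp
next
  case (Suc k)
  then obtain g h where gh: "b = g + h" "(\<Sum>i\<in>UNIV. g $ i) = k" by auto
  have "(\<Sum>i\<in>UNIV. b $ i) = k + (\<Sum>i\<in>UNIV. h $ i)" by (simp add: gh sum.distrib)
  with Suc.prems have "(\<Sum>i\<in>UNIV. h $ i) \<noteq> 0" by linarith
  then obtain i where i: "h $ i \<noteq> 0" by (meson sum.neutral)
  have sum_axis: "(\<Sum>j\<in>UNIV. (axis i 1 :: nat ^ 'n) $ j) = 1"
    by (simp add: axis_def if_distrib cong: if_cong)
  \<comment> \<open>The truncated subtraction is exact because \<open>h $ i\<close> is
    nonzero.\<close>
  have "b = (g + axis i 1) + (h - axis i 1)"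
    using i by (auto simp: gh vec_eq_iff axis_def)
  moreover have "(\<Sum>j\<in>UNIV. (g + axis i 1) $ j) = Suc k"
    using gh sum_axis by (simp add: sum.distrib)
  ultimately show ?case by blast
qed

lemma inj_real_point: "inj real_point"
  by (auto simp: inj_def real_point_def vec_eq_iff)

lemma square_in_sonc_cone:
  fixes g h :: "nat ^ 'n::finite"
  assumes ne: "g \<noteq> h" and g: "(\<Sum>i\<in>UNIV. g $ i) \<le> d" and h: "(\<Sum>i\<in>UNIV. h $ i) \<le> d"
    and d: "d \<ge> 1"
  shows "Poly_Mapping.single (g + g) 1 + Poly_Mapping.single (h + h) 1
    + Poly_Mapping.single (g + h) 2 \<in> sonc_cone (2 * d)" (is "?f \<in> _")
proof (rule circuit_in_sonc_cone)
  let ?A = "{g + g, h + h, g + h}"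
  define p q where "p = real_point (g + g)" and "q = real_point (h + h)"
  have pq: "p \<noteq> q"
    using ne by (auto simp: p_def q_def real_point_def vec_eq_iff)
  have mid: "real_point (g + h) = (1 / 2) *\<^sub>R p + (1 / 2) *\<^sub>R q"
    by (simp add: p_def q_def real_point_def vec_eq_iff)
  have "real_point (g + h) = midpoint p q"
    by (simp add: mid midpoint_def scaleR_add_right)
  then have "real_point (g + h) \<in> convex hull {p, q}"
    by (simp flip: segment_convex_hull)
  \<comment> \<open>The inner exponent is the midpoint of \<open>p\<close> and \<open>q\<close>, so
    it does not enlarge the hull, which is the segment between them.\<close>
  then have "convex hull insert (real_point (g + h)) {p, q} = convex hull {p, q}"
    by (rule hull_redundant)
  moreover have "real_point ` ?A = insert (real_point (g + h)) {p, q}"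
    by (auto simp: p_def q_def)
  ultimately have hull: "convex hull (real_point ` ?A) = closed_segment p q"
    by (simp only: segment_convex_hull)
  have mid_ne: "real_point (g + h) \<noteq> p" "real_point (g + h) \<noteq> q"
    using ne by (auto simp: p_def q_def inj_eq[OF inj_real_point])
  \<comment> \<open>A segment has only its endpoints as extreme points, and \<open>mid_ne\<close>
    rules out the midpoint.\<close>
  have v: "vertices ?A = {g + g, h + h}"
    unfolding vertices_def hull using mid_ne
    by (auto simp: extreme_point_of_segment p_def[symmetric] q_def[symmetric])
  have keys: "Poly_Mapping.keys ?f \<subseteq> ?A"
    by (auto simp: in_keys_iff lookup_add lookup_single when_def split: if_splits)
  let ?\<alpha> = "\<lambda>j::nat. if j = 0 then g + g else h + h"
  have img: "?\<alpha> ` {..1} = {g + g, h + h}"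
    by (auto simp: image_iff intro: exI[of _ "1::nat"])
  have "\<not> affine_dependent {p, q}" by simp
  then have aff: "\<not> affine_dependent (real_point ` ?\<alpha> ` {..1})"
    unfolding img by (simp add: p_def q_def)
  have gh: "g + g \<noteq> h + h" using pq by (auto simp: p_def q_def)
  \<comment> \<open>A circuit with two vertices, so \<open>r = 1\<close>, which is at most
    \<open>CARD('n)\<close> because the index type is nonempty; both barycentric weights are
    \<open>1/2\<close>.\<close>
  show "?f \<in> circuit_polys ?A"
    unfolding circuit_polys_def mem_Collect_eq v
    by (intro conjI exI[of _ 1] exI[of _ ?\<alpha>] exI[of _ "g + h"] exI[of _ "\<lambda>_. 1"]
        exI[of _ "2::real"] exI[of _ "\<lambda>_. 1/2"] aff img keys)
       (use gh mid in \<open>auto simp: even_point_def inj_on_def p_def q_def atMost_Suc Suc_le_eq\<close>)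
  have deg: "(\<Sum>i\<in>UNIV. a $ i) \<le> 2 * d" if "a \<in> ?A" for a
    using that g h by (auto simp: sum.distrib)
  then show "?A \<subseteq> simplex_lattice_points (2 * d)"
    using d by (intro subsetI simplex_lattice_pointsI) auto
  have "mpoly_eval ?f x = ((\<Prod>i\<in>UNIV. x $ i ^ g $ i) + (\<Prod>i\<in>UNIV. x $ i ^ h $ i))\<^sup>2" for x
    by (simp add: mpoly_eval_add mpoly_eval_single power_add prod.distrib power2_eq_square
        algebra_simps)
  then show "?f \<in> nonneg_cone (2 * d)"
    using keys deg by (auto simp: nonneg_cone_def mpoly_degree_le_iff simp del: insert_iff)
qed

lemma single_in_span_sonc_cone:
  fixes b :: "nat ^ 'n::finite"
  assumes "(\<Sum>i\<in>UNIV. b $ i) \<le> 2 * d" "d \<ge> 1"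
  shows "Poly_Mapping.single b 1 \<in> span (sonc_cone (2 * d))"
proof (cases "even_point b")
  case True
  then show ?thesis
    using assms by (intro span_base single_in_sonc_cone) auto
next
  case False
  \<comment> \<open>Taking \<open>min d\<close> of the degree of \<open>b\<close> for
    \<open>g\<close> leaves \<open>h\<close> of degree zero if \<open>b\<close> has degree at most
    \<open>d\<close>, and of degree at most \<open>2 * d - d\<close> otherwise.\<close>
  obtain g h where gh: "b = g + h" "(\<Sum>i\<in>UNIV. g $ i) = min d (\<Sum>i\<in>UNIV. b $ i)"
    using split_exponent[of "min d (\<Sum>i\<in>UNIV. b $ i)" b] by auto
  have "(\<Sum>i\<in>UNIV. b $ i) = (\<Sum>i\<in>UNIV. g $ i) + (\<Sum>i\<in>UNIV. h $ i)"
    by (simp add: gh(1) sum.distrib)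
  then have le: "(\<Sum>i\<in>UNIV. g $ i) \<le> d" "(\<Sum>i\<in>UNIV. h $ i) \<le> d"
    using gh(2) assms by linarith+
  \<comment> \<open>Equality would make \<open>b = g + g\<close> even.\<close>
  have "g \<noteq> h" using False by (auto simp: gh(1) even_point_def)
  let ?g = "Poly_Mapping.single (g + g) (1::real)" and ?h = "Poly_Mapping.single (h + h) (1::real)"
  let ?f = "?g + ?h + Poly_Mapping.single (g + h) (2::real)"
  have "?f \<in> span (sonc_cone (2 * d))"
    using \<open>g \<noteq> h\<close> le assms by (intro span_base square_in_sonc_cone)
  moreover have "?g \<in> span (sonc_cone (2 * d))" "?h \<in> span (sonc_cone (2 * d))"
    using le assms
    by (auto simp: even_point_def sum.distrib intro!: span_base single_in_sonc_cone)
  ultimately have "(1 / 2) *\<^sub>R (?f - ?g - ?h) \<in> span (sonc_cone (2 * d))"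
    by (intro span_scale span_diff)
  also have "(1 / 2) *\<^sub>R (?f - ?g - ?h) = Poly_Mapping.single b 1"
    by (rule poly_mapping_eqI) (simp add: gh(1) lookup_add lookup_minus lookup_single when_def)
  finally show ?thesis .
qed

theorem theorem4p3:
  fixes d :: nat
  assumes "d \<ge> 1"
  shows "(sonc_cone (2 * d) :: 'n::finite mpoly_real set) \<subseteq> nonneg_cone (2 * d) \<and>
         dim (span (sonc_cone (2 * d) :: 'n mpoly_real set)) =
         dim (span (nonneg_cone (2 * d) :: 'n mpoly_real set))"
proof
  show sub: "(sonc_cone (2 * d) :: 'n mpoly_real set) \<subseteq> nonneg_cone (2 * d)"
    by (rule sonc_cone_subset_nonneg_cone)
  \<comment> \<open>The degree bound applies to each exponent in the support, so \<open>f\<close> is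
    a linear combination of monomials already known to lie in the span.\<close>
  have "f \<in> span (sonc_cone (2 * d))" if "f \<in> nonneg_cone (2 * d)" for f :: "'n mpoly_real"
    using that assms
    by (subst poly_mapping_eq_sum_scaleR_single)
       (auto simp: nonneg_cone_def mpoly_degree_le_iff
         intro!: span_sum span_scale single_in_span_sonc_cone)
  \<comment> \<open>The dimensions agree because the two spans are the same set; no basis has to be
    exhibited.\<close>
  then have "span (sonc_cone (2 * d) :: 'n mpoly_real set) = span (nonneg_cone (2 * d))"
    using sub by (intro subset_antisym span_mono span_minimal) auto
  then show "dim (span (sonc_cone (2 * d) :: 'n mpoly_real set)) =
      dim (span (nonneg_cone (2 * d) :: 'n mpoly_real set))"
    by simp
qed

end
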